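(* Let $G=(V,E)$ be a weakly connected directed acyclic graph with $n\ge 2$ nodes and fixed delays $m_{i,j}$, and let $(\mathcal{N}^e,\mathcal{N}^m)$ be an identification pattern. If the network $G$ is identifiable in the class $\mathcal{F}_{Z,NL}$ with $(\mathcal{N}^e,\mathcal{N}^m)$, then every sink of $G$ belongs to $\mathcal{N}^m$ (is measured) and every source of $G$ belongs to $\mathcal{N}^e$ (is excited).
   Context: Graph. $G=(V,E)$ is a weakly connected directed acyclic graph (DAG), $V=\{1,\dots,n\}$, $E\subseteq V\times V$. An element $(i,j)\in E$ denotes an edge from $j$ to $i$; $\mathcal{N}_i=\{j:(i,j)\in E\}$ is the set of in-neighbors of $i$. A source is a node with no in-neighbors; a sink is a node with no out-neighbors. Identification pattern. A pair $(\mathcal{N}^e,\mathcal{N}^m)$ with $\mathcal{N}^e\subseteq V$ (excited nodes) and $\mathcal{N}^m\subseteq V$ (measured nodes). Model. Each edge $(i,j)\in E$ carries a fixed known finite delay $m_{i,j}\in\{1,2,\dots\}$ and a function $f_{i,j}:\mathbb{R}\to\mathbb{R}$. The node outputs satisfy, at each time $k$, $$y_i^k=\sum_{j\in\mathcal{N}_i} f_{i,j}\big(y_j^{k-m_{i,j}}\big)+u_i^{k-1},\qquad i\in V,$$ where superscripts denote time instants, $u_i$ is an arbitrary real excitation signal if $i\in\mathcal{N}^e$, and $u_i\equiv 0$ if $i\notin\mathcal{N}^e$. The functions $F_i$. Since $G$ is acyclic, unrolling the model gives $y_i^k=u_i^{k-1}+F_i$, where $F_i$ is a function of finitely many delayed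 values $u_j^{k-s}$ of the excitation signals of excited nodes $j$ having a path to $i$. Explicitly, $F_i=\sum_{j\in\mathcal{N}_i} f_{i,j}\big(u_j^{k-m_{i,j}-1}+F_j^{(m_{i,j})}\big)$, where $F_j^{(s)}$ is $F_j$ with all its inputs delayed by $s$, and $u_j=0$ for non-excited $j$. The set of measured functions is $F(\mathcal{N}^m)=\{F_i: i\in\mathcal{N}^m\}$. For another family $\{\tilde f\}=\{\tilde f_{i,j}\}$ on the same graph with the same delays and pattern, $\tilde F_i$ denotes the corresponding functions; $F(\mathcal{N}^m)=\tilde F(\mathcal{N}^m)$ means $F_i=\tilde F_i$ as functions (for all real values of the inputs) for each $i\in\mathcal{N}^m$. Class $\mathcal{F}_{Z,NL}$. The set of $f:\mathbb{R}\to\mathbb{R}$ such that: (1) $f$ is real analytic on $\mathbb{R}$; (2) $f(0)=0$; (3) the Taylor series $f(x)=\sum_{n\ge1}a_nx^n$ at $0$ has some $a_n\ne0$ with $n>1$; (4) the range of $f$ is $\mathbb{R}$. Identifiability. $G$ is identifiable in $\mathcal{F}_{Z,NL}$ with $(\mathcal{N}^e,\mathcal{N}^m)$ if, for all families $\{f_{i,j}\}_{(i,j)\in E}$ and $\{\tilde f_{i,j}\}_{(i,j)\in E}$ of functions in $\mathcal{F}_{Z,NL}$, $F(\mathcal{N}^m)=\tilde F(\mathcal{N}^m)$ implies $f_{i,j}=\tilde f_{i,j}$ for all $(i,j)\in E$. *)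

theory Defs
  imports "HOL-Analysis.Analysis"
begin

(* A pair (i, j) in an edge set is an edge from j to i. *)

definition in_neighbors :: "(nat \<times> nat) set \<Rightarrow> nat \<Rightarrow> nat set" where
  "in_neighbors E i = {j. (i, j) \<in> E}"

definition out_neighbors :: "(nat \<times> nat) set \<Rightarrow> nat \<Rightarrow> nat set" where
  "out_neighbors E j = {i. (i, j) \<in> E}"

definition source :: "nat set \<Rightarrow> (nat \<times> nat) set \<Rightarrow> nat \<Rightarrow> bool" where
  "source V E i \<longleftrightarrow> i \<in> V \<and> in_neighbors E i = {}"

definition sink :: "nat set \<Rightarrow> (nat \<times> nat) set \<Rightarrow> nat \<Rightarrow> bool" where
  "sink V E i \<longleftrightarrow> i \<in> V \<and> out_neighbors E i = {}"

definition weakly_connected :: "nat set \<Rightarrow> (nat \<times> nat) set \<Rightarrow> bool" where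
  "weakly_connected V E \<longleftrightarrow> (\<forall>i\<in>V. \<forall>j\<in>V. (i, j) \<in> (E \<union> E\<inverse>)\<^sup>*)"

(* An input array w lists past excitation values relative to the current time k:
   w j s stands for the value of u_j at time k - s. *)
type_synonym inputs = "nat \<Rightarrow> nat \<Rightarrow> real"

definition delayed :: "nat \<Rightarrow> (inputs \<Rightarrow> real) \<Rightarrow> inputs \<Rightarrow> real" where
  "delayed s \<Phi> w = \<Phi> (\<lambda>j t. w j (t + s))"

(* The function F_i, obtained by unrolling the model along the edges. Entries of w at
   non-excited nodes are read as 0, so F_i depends on the excited inputs only and ranges
   over all their real values. The recursion is well-founded on a finite acyclic graph,
   where it satisfies F_fun_rec below. *)
definition F_fun ::
  "(nat \<times> nat) set \<Rightarrow> (nat \<Rightarrow> nat \<Rightarrow> nat) \<Rightarrow> nat set \<Rightarrow> (nat \<Rightarrow> nat \<Rightarrow> real \<Rightarrow> real) \<Rightarrow> nat \<Rightarrow> inputs \<Rightarrow> real"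
  where
  "F_fun E m Ne f = wfrec (E\<inverse>) (\<lambda>\<Phi> i w. \<Sum>j\<in>in_neighbors E i.
      f i j ((if j \<in> Ne then w j (m i j + 1) else 0) + delayed (m i j) (\<Phi> j) w))"

lemma F_fun_rec:
  assumes "finite E" "acyclic E"
  shows "F_fun E m Ne f i w = (\<Sum>j\<in>in_neighbors E i.
      f i j ((if j \<in> Ne then w j (m i j + 1) else 0) + delayed (m i j) (F_fun E m Ne f j) w))"
proof -
  have wf: "wf (E\<inverse>)"
    using assms by (rule finite_acyclic_wf_converse)
  show ?thesis
    unfolding F_fun_def
    by (subst wfrec[OF wf], intro sum.cong refl) (simp add: cut_apply in_neighbors_def)
qed

definition satisfies_model ::
  "nat set \<Rightarrow> (nat \<times> nat) set \<Rightarrow> (nat \<Rightarrow> nat \<Rightarrow> nat) \<Rightarrow> nat set \<Rightarrow> (nat \<Rightarrow> nat \<Rightarrow> real \<Rightarrow> real)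
    \<Rightarrow> (nat \<Rightarrow> int \<Rightarrow> real) \<Rightarrow> (nat \<Rightarrow> int \<Rightarrow> real) \<Rightarrow> bool" where
  "satisfies_model V E m Ne f u y \<longleftrightarrow>
     (\<forall>i k. i \<notin> Ne \<longrightarrow> u i k = 0) \<and>
     (\<forall>i\<in>V. \<forall>k. y i k = (\<Sum>j\<in>in_neighbors E i. f i j (y j (k - int (m i j)))) + u i (k - 1))"

(* F_fun is indeed the unrolled form of the model. *)
lemma model_output:
  assumes fin: "finite E" and acyc: "acyclic E" and EV: "E \<subseteq> V \<times> V"
    and mdl: "satisfies_model V E m Ne f u y"
    and iV: "i \<in> V"
  shows "y i k = u i (k - 1) + F_fun E m Ne f i (\<lambda>j s. u j (k - int s))"
proof -
  have "wf (E\<inverse>)"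
    using fin acyc by (rule finite_acyclic_wf_converse)
  then have "i \<in> V \<longrightarrow> (\<forall>k. y i k = u i (k - 1) + F_fun E m Ne f i (\<lambda>j s. u j (k - int s)))"
  proof (induction i rule: wf_induct_rule)
    case (less i)
    show ?case
    proof (intro impI allI)
      fix k assume "i \<in> V"
      then have "y i k = (\<Sum>j\<in>in_neighbors E i. f i j (y j (k - int (m i j)))) + u i (k - 1)"
        using mdl by (auto simp: satisfies_model_def)
      moreover have "f i j (y j (k - int (m i j))) =
          f i j ((if j \<in> Ne then u j (k - int (m i j + 1)) else 0)
            + delayed (m i j) (F_fun E m Ne f j) (\<lambda>j s. u j (k - int s)))"
        if "j \<in> in_neighbors E i" for j
      proof -
        have "j \<in> V" "(j, i) \<in> E\<inverse>"
          using that EV by (auto simp: in_neighbors_def)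
        then have "y j (k - int (m i j)) = u j (k - int (m i j) - 1)
            + F_fun E m Ne f j (\<lambda>l s. u l (k - int (m i j) - int s))"
          using less.IH by blast
        moreover have "(if j \<in> Ne then u j (k - int (m i j + 1)) else 0) = u j (k - int (m i j) - 1)"
          using mdl by (auto simp: satisfies_model_def algebra_simps)
        ultimately show ?thesis
          by (simp add: delayed_def algebra_simps)
      qed
      ultimately show "y i k = u i (k - 1) + F_fun E m Ne f i (\<lambda>j s. u j (k - int s))"
        by (subst F_fun_rec[OF fin acyc]) simp
    qed
  qed
  then show ?thesis
    using iV by blast
qed

definition real_analytic :: "(real \<Rightarrow> real) \<Rightarrow> bool" where
  "real_analytic f \<longleftrightarrow> (\<forall>x. \<exists>A. (\<lambda>h. f (x + h)) has_fps_expansion A)"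

definition class_Z_NL :: "(real \<Rightarrow> real) set" where
  "class_Z_NL = {f. real_analytic f \<and> f 0 = 0 \<and>
     (\<exists>A. f has_fps_expansion A \<and> (\<exists>n>1. fps_nth A n \<noteq> 0)) \<and>
     range f = UNIV}"

definition identifiable ::
  "(real \<Rightarrow> real) set \<Rightarrow> (nat \<times> nat) set \<Rightarrow> (nat \<Rightarrow> nat \<Rightarrow> nat) \<Rightarrow> nat set \<Rightarrow> nat set \<Rightarrow> bool" where
  "identifiable C E m Ne Nm \<longleftrightarrow>
     (\<forall>f f'. (\<forall>(i, j)\<in>E. f i j \<in> C \<and> f' i j \<in> C) \<longrightarrow>
        (\<forall>i\<in>Nm. F_fun E m Ne f i = F_fun E m Ne f' i) \<longrightarrow>
        (\<forall>(i, j)\<in>E. f i j = f' i j))"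

end

theory Submission
  imports Defs
begin

text \<open>Let every edge carry the cube function, and let a second family differ only in carrying
  twice the cube on a single edge. If that edge enters an unmeasured sink, no measured output
  passes through it; if it leaves an unexcited source, its argument is always 0, where both
  functions vanish. In either case the measured functions coincide.\<close>

text \<open>An odd degree gives range \<real>, and a degree above 1 gives the required nonlinear
  Taylor coefficient; a nonzero factor spoils neither.\<close>

lemma scaled_cube_in_class_Z_NL:
  fixes c :: real
  assumes "c \<noteq> 0"
  shows "(\<lambda>x. c * x ^ 3) \<in> class_Z_NL"
proof -
  \<comment> \<open>Analyticity needs the expansion about every \<open>x\<close>; its instance at 0
    is \<open>c\<close> times the cube of \<open>fps_X\<close>, with coefficient \<open>c\<close> in
    degree 3.\<close>
  have X: "(\<lambda>h. c * (x + h) ^ 3) has_fps_expansion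
      fps_const c * (fps_const x + fps_X) ^ 3" for x
    unfolding power3_eq_cube by (intro fps_expansion_intros)
  have "\<exists>n>1. fps_nth (fps_const c * (fps_const 0 + fps_X) ^ 3) n \<noteq> 0"
    using assms by (intro exI[of _ 3]) simp
  with X[of 0] have "\<exists>A. (\<lambda>x. c * x ^ 3) has_fps_expansion A \<and> (\<exists>n>1. fps_nth A n \<noteq> 0)"
    by auto
  moreover have "range (\<lambda>x. c * x ^ 3) = UNIV"
  proof (rule surjI)
    \<comment> \<open>The root of odd order inverts the cube for either sign of
      \<open>y / c\<close>.\<close>
    show "c * root 3 (y / c) ^ 3 = y" for y
      using assms by (simp add: odd_real_root_pow)
  qed
  ultimately show ?thesis
    using X unfolding class_Z_NL_def real_analytic_def by auto
qed

definition cubes_scaled_at :: "real \<Rightarrow> nat \<Rightarrow> nat \<Rightarrow> nat \<Rightarrow> nat \<Rightarrow> real \<Rightarrow> real" where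
  "cubes_scaled_at c p q = (\<lambda>i j x. (if i = p \<and> j = q then c else 1) * x ^ 3)"

text \<open>Both families lie in the class but differ on the edge from \<open>q\<close> to
  \<open>p\<close>, so by identifiability some measured node must tell them apart.\<close>

lemma identifiable_measures_scaling:
  assumes "identifiable class_Z_NL E m Ne Nm" "(p, q) \<in> E"
  shows "\<exists>i\<in>Nm. F_fun E m Ne (cubes_scaled_at 1 p q) i \<noteq> F_fun E m Ne (cubes_scaled_at 2 p q) i"
proof (rule ccontr)
  assume "\<not> ?thesis"
  then have "\<forall>i\<in>Nm. F_fun E m Ne (cubes_scaled_at 1 p q) i = F_fun E m Ne (cubes_scaled_at 2 p q) i"
    by blast
  moreover have "cubes_scaled_at c p q i j \<in> class_Z_NL" if "c \<noteq> 0" for c i j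
    unfolding cubes_scaled_at_def using that by (intro scaled_cube_in_class_Z_NL) simp
  then have "\<forall>(i, j)\<in>E. cubes_scaled_at 1 p q i j \<in> class_Z_NL \<and> cubes_scaled_at 2 p q i j \<in> class_Z_NL"
    by simp
  ultimately have "\<forall>(i, j)\<in>E. cubes_scaled_at 1 p q i j = cubes_scaled_at 2 p q i j"
    using assms(1) unfolding identifiable_def by blast
  with assms(2) have "cubes_scaled_at 1 p q p q = cubes_scaled_at 2 p q p q"
    by blast
  from fun_cong[OF this, of 1] show False
    by (simp add: cubes_scaled_at_def)
qed

text \<open>Unrolling \<open>F_fun\<close> at \<open>i\<close> uses the functions on edges into
  \<open>i\<close> and the values of \<open>F_fun\<close> at in-neighbors of \<open>i\<close>. A
  sink \<open>p\<close> is nobody's in-neighbor, so the recursion never reaches an edge into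
  \<open>p\<close>.\<close>

lemma F_fun_cong_avoiding_sink:
  assumes "finite E" "acyclic E" "out_neighbors E p = {}"
    and agree: "\<And>k j. k \<noteq> p \<Longrightarrow> f k j = f' k j"
    and "i \<noteq> p"
  shows "F_fun E m Ne f i = F_fun E m Ne f' i"
proof -
  have "wf (E\<inverse>)"
    using assms by (intro finite_acyclic_wf_converse)
  then show ?thesis
    using \<open>i \<noteq> p\<close>
  proof (induction i rule: wf_induct_rule)
    case (less i)
    have "F_fun E m Ne f j = F_fun E m Ne f' j" if "j \<in> in_neighbors E i" for j
      using that less.IH assms(3) by (auto simp: in_neighbors_def out_neighbors_def)
    then show ?case
      using agree[OF less.prems]
      by (intro ext, subst (1 2) F_fun_rec[OF assms(1,2)]) (simp add: delayed_def)
  qed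
qed

text \<open>At \<open>q\<close> the sum over in-neighbors is empty and the excitation reads 0, so
  functions on edges leaving \<open>q\<close> are only ever evaluated at 0.\<close>

lemma F_fun_cong_unexcited_source:
  assumes "finite E" "acyclic E" "in_neighbors E q = {}" "q \<notin> Ne"
    and agree: "\<And>k j. j \<noteq> q \<Longrightarrow> f k j = f' k j"
    and agree0: "\<And>k. f k q 0 = f' k q 0"
  shows "F_fun E m Ne f i = F_fun E m Ne f' i"
proof -
  have zero: "F_fun E m Ne h q w = 0" for h w
    by (subst F_fun_rec[OF assms(1,2)]) (simp add: assms(3))
  have "wf (E\<inverse>)"
    using assms by (intro finite_acyclic_wf_converse)
  then show ?thesis
  proof (induction i rule: wf_induct_rule)
    case (less i)
    show ?case
    proof
      fix w
      have "f i j ((if j \<in> Ne then w j (m i j + 1) else 0) + delayed (m i j) (F_fun E m Ne f j) w)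
          = f' i j ((if j \<in> Ne then w j (m i j + 1) else 0) + delayed (m i j) (F_fun E m Ne f' j) w)"
        if "j \<in> in_neighbors E i" for j
      proof (cases "j = q")
        case True
        then show ?thesis
          using \<open>q \<notin> Ne\<close> agree0 by (simp add: delayed_def zero)
      next
        case False
        then show ?thesis
          using that less.IH[of j] agree by (simp add: in_neighbors_def)
      qed
      then show "F_fun E m Ne f i w = F_fun E m Ne f' i w"
        by (subst (1 2) F_fun_rec[OF assms(1,2)]) (rule sum.cong[OF refl])
    qed
  qed
qed

lemma weakly_connected_incident_edge:
  assumes "weakly_connected V E" "i \<in> V" "j \<in> V" "i \<noteq> j"
  shows "in_neighbors E i \<noteq> {} \<or> out_neighbors E i \<noteq> {}"
proof -
  have "(i, j) \<in> (E \<union> E\<inverse>)\<^sup>*"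
    using assms by (simp add: weakly_connected_def)
  then show ?thesis
    \<comment> \<open>As the endpoints differ, the undirected path has a first step, which is an
      edge at \<open>i\<close>.\<close>
    using \<open>i \<noteq> j\<close>
    by (cases rule: converse_rtranclE) (auto simp: in_neighbors_def out_neighbors_def)
qed

theorem lemma1:
  fixes n :: nat
    and E :: "(nat \<times> nat) set"
    and m :: "nat \<Rightarrow> nat \<Rightarrow> nat"
    and Ne Nm :: "nat set"
  assumes "n \<ge> 2"
    and "E \<subseteq> {1..n} \<times> {1..n}"
    and "acyclic E"
    and "weakly_connected {1..n} E"
    and "\<forall>(i, j)\<in>E. m i j \<ge> 1"
    and "Ne \<subseteq> {1..n}"
    and "Nm \<subseteq> {1..n}"
    and "identifiable class_Z_NL E m Ne Nm"
  shows "(\<forall>i. sink {1..n} E i \<longrightarrow> i \<in> Nm) \<and> (\<forall>i. source {1..n} E i \<longrightarrow> i \<in> Ne)"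
proof -
  have fin: "finite E"
    using assms(2) by (rule finite_subset) simp
  \<comment> \<open>Since \<open>n\<close> is at least 2, one of the nodes 1 and 2 differs from
    \<open>i\<close> and can serve as the other end of the path.\<close>
  have incident: "in_neighbors E i \<noteq> {} \<or> out_neighbors E i \<noteq> {}" if "i \<in> {1..n}" for i
    using weakly_connected_incident_edge[OF assms(4) that, of "if i = 1 then 2 else 1"] \<open>n \<ge> 2\<close>
    by (auto split: if_splits)
  have "i \<in> Nm" if sink: "sink {1..n} E i" for i
  proof -
    have out: "out_neighbors E i = {}"
      using sink by (simp add: sink_def)
    then obtain q where "(i, q) \<in> E"
      using incident[of i] sink by (auto simp: sink_def in_neighbors_def)
    then obtain k where "k \<in> Nm"
      "F_fun E m Ne (cubes_scaled_at 1 i q) k \<noteq> F_fun E m Ne (cubes_scaled_at 2 i q) k"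
      using identifiable_measures_scaling[OF assms(8)] by blast
    \<comment> \<open>The scaled edge enters the sink \<open>i\<close>, so only \<open>i\<close>
      itself can see the change.\<close>
    moreover from this(2) have "k = i"
      using F_fun_cong_avoiding_sink[OF fin assms(3) out,
          of "cubes_scaled_at 1 i q" "cubes_scaled_at 2 i q"]
      by (auto simp: cubes_scaled_at_def)
    ultimately show ?thesis
      by simp
  qed
  moreover have "i \<in> Ne" if source: "source {1..n} E i" for i
  proof (rule ccontr)
    assume "i \<notin> Ne"
    have ins: "in_neighbors E i = {}"
      using source by (simp add: source_def)
    then obtain p where "(p, i) \<in> E"
      using incident[of i] source by (auto simp: source_def out_neighbors_def)
    then obtain k where
      "F_fun E m Ne (cubes_scaled_at 1 p i) k \<noteq> F_fun E m Ne (cubes_scaled_at 2 p i) k"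
      using identifiable_measures_scaling[OF assms(8)] by blast
    \<comment> \<open>Both families vanish at 0 and differ only on an edge leaving \<open>i\<close>,
      so no node can distinguish them.\<close>
    then show False
      using F_fun_cong_unexcited_source[OF fin assms(3) ins \<open>i \<notin> Ne\<close>,
          of "cubes_scaled_at 1 p i" "cubes_scaled_at 2 p i"]
      by (auto simp: cubes_scaled_at_def)
  qed
  ultimately show ?thesis
    by blast
qed

end
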